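(* Let $p\in(1,2]$ and let $(X,d)$ be a proper geodesic metric space that is $p$-uniformly smooth. Then for every ray $\gamma:[0,\infty)\to X$ the Busemann function $b_\gamma$ is convex. In particular, all Cheeger-Gromoll functions $b_{x_0}$, $x_0\in X$, are convex.
   Context: A geodesic from $x$ to $y$ is a map $\gamma:[0,1]\to X$ with $\gamma(0)=x$, $\gamma(1)=y$ and $d(\gamma(t),\gamma(s))=|t-s|\,d(x,y)$; $X$ is geodesic if any two points are joined by a geodesic, and proper if closed bounded subsets are compact. A midpoint of $y,z$ is a point $m$ with $d(y,m)=d(m,z)=\frac12d(y,z)$. $(X,d)$ is $p$-uniformly smooth if there is $C>0$ such that for all $x,y,z\in X$ and every midpoint $m$ of $y$ and $z$, $$d(x,m)^p\ge\tfrac12d(x,y)^p+\tfrac12d(x,z)^p-\tfrac C4d(y,z)^p.$$ A ray is an isometric embedding $\gamma:[0,\infty)\to X$; its Busemann function is $b_\gamma(x)=\lim_{t\to\infty}\big(t-d(\gamma(t),x)\big)$. The Cheeger-Gromoll function with respect to $x_0$ is $b_{x_0}(x)=\sup b_\gamma(x)$, the supremum over all rays $\gamma$ with $\gamma(0)=x_0$ (it is considered when at least one such ray exists). A function $f:X\to\mathbb{R}$ is convex if $t\mapsto f(\gamma(t))$ is convex on $[0,1]$ for every geodesic $\gamma:[0,1]\to X$. *)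

theory Defs
  imports "HOL-Analysis.Analysis"
begin

text \<open>The metric space $X$ is the whole type \<^typ>\<open>'a::metric_space\<close>. Maps defined on $[0,1]$
  or $[0,\infty)$ are functions on \<^typ>\<open>real\<close> constrained only on that interval.\<close>

definition geodesic_from_to :: "(real \<Rightarrow> 'a::metric_space) \<Rightarrow> 'a \<Rightarrow> 'a \<Rightarrow> bool" where
  "geodesic_from_to \<gamma> x y \<longleftrightarrow> \<gamma> 0 = x \<and> \<gamma> 1 = y \<and>
     (\<forall>s\<in>{0..1}. \<forall>t\<in>{0..1}. dist (\<gamma> t) (\<gamma> s) = \<bar>t - s\<bar> * dist x y)"

definition geodesic_space :: "'a::metric_space itself \<Rightarrow> bool" where
  "geodesic_space _ \<longleftrightarrow> (\<forall>x y :: 'a. \<exists>\<gamma>. geodesic_from_to \<gamma> x y)"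

definition proper_space :: "'a::metric_space itself \<Rightarrow> bool" where
  "proper_space _ \<longleftrightarrow> (\<forall>S :: 'a set. closed S \<and> bounded S \<longrightarrow> compact S)"

definition is_midpoint :: "'a::metric_space \<Rightarrow> 'a \<Rightarrow> 'a \<Rightarrow> bool" where
  "is_midpoint m y z \<longleftrightarrow> dist y m = dist y z / 2 \<and> dist m z = dist y z / 2"

definition uniformly_smooth :: "real \<Rightarrow> 'a::metric_space itself \<Rightarrow> bool" where
  "uniformly_smooth p _ \<longleftrightarrow> (\<exists>C>0. \<forall>x y z m :: 'a. is_midpoint m y z \<longrightarrow>
     dist x m powr p \<ge> 1/2 * dist x y powr p + 1/2 * dist x z powr p - C/4 * dist y z powr p)"

definition ray :: "(real \<Rightarrow> 'a::metric_space) \<Rightarrow> bool" where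
  "ray \<gamma> \<longleftrightarrow> (\<forall>s\<ge>0. \<forall>t\<ge>0. dist (\<gamma> s) (\<gamma> t) = \<bar>s - t\<bar>)"

definition busemann :: "(real \<Rightarrow> 'a::metric_space) \<Rightarrow> 'a \<Rightarrow> real" where
  "busemann \<gamma> x = Lim at_top (\<lambda>t. t - dist (\<gamma> t) x)"

text \<open>By \<open>busemann_le\<close> below, the set is bounded above, so this real-valued supremum is
  the intended one as soon as some ray starts at \<open>x0\<close>.\<close>

definition cheeger_gromoll :: "'a::metric_space \<Rightarrow> 'a \<Rightarrow> real" where
  "cheeger_gromoll x0 x = Sup {busemann \<gamma> x | \<gamma>. ray \<gamma> \<and> \<gamma> 0 = x0}"

definition geodesically_convex :: "('a::metric_space \<Rightarrow> real) \<Rightarrow> bool" where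
  "geodesically_convex f \<longleftrightarrow>
     (\<forall>\<gamma> x y. geodesic_from_to \<gamma> x y \<longrightarrow> convex_on {0..1} (\<lambda>t. f (\<gamma> t)))"

lemma busemann_aux:
  assumes "ray \<gamma>"
  shows "((\<lambda>t. t - dist (\<gamma> t) x) \<longlongrightarrow> busemann \<gamma> x) at_top" and busemann_le: "busemann \<gamma> x \<le> dist (\<gamma> 0) x"
proof -
  define f where "f t = t - dist (\<gamma> t) x" for t
  have mono: "f s \<le> f t" if "0 \<le> s" "s \<le> t" for s t
  proof -
    have "dist (\<gamma> t) (\<gamma> s) = t - s" using assms that by (auto simp: ray_def)
    then show ?thesis using dist_triangle[of "\<gamma> t" x "\<gamma> s"] by (simp add: f_def)
  qed
  have bound: "f t \<le> dist (\<gamma> 0) x" if "0 \<le> t" for t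
  proof -
    have "dist (\<gamma> t) (\<gamma> 0) = t" using assms that by (auto simp: ray_def)
    then show ?thesis using dist_triangle2[of "\<gamma> t" "\<gamma> 0" x] by (simp add: f_def)
  qed
  define l where "l = (SUP t\<in>{0..}. f t)"
  have bdd: "bdd_above (f ` {0..})" using bound by (auto intro!: bdd_aboveI2)
  have up: "f t \<le> l" if "0 \<le> t" for t
    unfolding l_def using bdd that by (intro cSUP_upper) auto
  have lim: "(f \<longlongrightarrow> l) at_top"
  proof (rule order_tendstoI)
    fix a assume "a < l"
    then obtain s where s: "s \<ge> 0" "a < f s"
      using bdd unfolding l_def by (subst (asm) less_cSUP_iff) auto
    show "eventually (\<lambda>t. a < f t) at_top"
      using eventually_ge_at_top[of s] by eventually_elim (use s mono in force)
  next
    fix a assume "l < a"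
    show "eventually (\<lambda>t. f t < a) at_top"
      using eventually_ge_at_top[of 0] by eventually_elim (use up \<open>l < a\<close> in force)
  qed
  have eq: "busemann \<gamma> x = l"
    unfolding busemann_def f_def[symmetric] by (rule tendsto_Lim[OF _ lim]) simp
  show "((\<lambda>t. t - dist (\<gamma> t) x) \<longlongrightarrow> busemann \<gamma> x) at_top"
    using lim unfolding eq f_def .
  show "busemann \<gamma> x \<le> dist (\<gamma> 0) x"
    unfolding eq l_def by (rule cSUP_least) (use bound in auto)
qed

lemmas busemann_tendsto = busemann_aux(1)

end

theory Submission
  imports Defs
begin

text \<open>Apply uniform smoothness at \<open>\<gamma> t\<close> to a midpoint \<open>m\<close> of \<open>y\<close> and \<open>z\<close>. By convexity of
  \<open>r \<mapsto> r powr p\<close> the mean \<open>a\<close> of the distances from \<open>\<gamma> t\<close> to \<open>y\<close> and \<open>z\<close> satisfies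
  \<open>a powr p \<le> dist (\<gamma> t) m powr p + K\<close> with \<open>K\<close> independent of \<open>t\<close>, hence
  \<open>a - dist (\<gamma> t) m \<le> K / a powr (p - 1)\<close>. As \<open>a\<close> tends to infinity with \<open>t\<close> and \<open>p > 1\<close>, the
  error vanishes in the limit and the Busemann function is midpoint convex. It is also
  1-Lipschitz, so it is convex, and so is any pointwise supremum of Busemann functions.\<close>

text \<open>The chord is affine, so subtracting it from \<open>f\<close> along a segment leaves a
  continuous midpoint-convex \<open>g\<close> that vanishes at both ends. A positive maximum of
  \<open>g\<close> would be interior, and midpoint convexity fails at the first point where it is
  attained.\<close>

lemma midpoint_convex_imp_convex_on:
  fixes f :: "'a::real_normed_vector \<Rightarrow> real"
  assumes "convex S" and cont: "continuous_on S f"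
    and mid: "\<And>x y. x \<in> S \<Longrightarrow> y \<in> S \<Longrightarrow> f (midpoint x y) \<le> (f x + f y) / 2"
  shows "convex_on S f"
proof (rule convex_onI)
  fix t :: real and x y
  assume t: "0 < t" "t < 1" and xy: "x \<in> S" "y \<in> S"
  define h where "h u = (1 - u) *\<^sub>R x + u *\<^sub>R y" for u
  define g where "g u = f (h u) - ((1 - u) * f x + u * f y)" for u
  have hS: "h u \<in> S" if "u \<in> {0..1}" for u
    using that \<open>convex S\<close> xy unfolding h_def by (auto simp: convex_alt)
  have "continuous_on {0..1} (f \<circ> h)"
    by (rule continuous_on_compose)
       (auto simp: h_def intro!: continuous_intros continuous_on_subset[OF cont] hS[unfolded h_def])
  then have gcont: "continuous_on {0..1} g"
    unfolding g_def comp_def by (intro continuous_intros)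
  have gmid: "g ((u + v) / 2) \<le> (g u + g v) / 2" if "u \<in> {0..1}" "v \<in> {0..1}" for u v
  proof -
    have "h ((u + v) / 2) = midpoint (h u) (h v)"
    proof -
      have "1 - (u + v) / 2 = (1/2) * ((1 - u) + (1 - v))" "(u + v) / 2 = (1/2) * (u + v)"
        by (simp_all add: field_simps)
      then show ?thesis
        by (simp only: h_def midpoint_def inverse_eq_divide scaleR_add_left scaleR_add_right
            add_ac flip: scaleR_scaleR)
    qed
    then show ?thesis
      using mid[OF hS[OF that(1)] hS[OF that(2)]] by (simp add: g_def field_simps)
  qed
  obtain w where w: "w \<in> {0..1}" "\<And>u. u \<in> {0..1} \<Longrightarrow> g u \<le> g w"
    using continuous_attains_sup[OF _ _ gcont] by auto
  have "g w \<le> 0"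
  proof (rule ccontr)
    assume "\<not> g w \<le> 0"
    define T where "T = {u \<in> {0..1}. g u = g w}"
    have "closed T"
      unfolding T_def by (rule continuous_closed_preimage_constant[OF gcont]) simp
    moreover have "T = {0..1} \<inter> T" by (auto simp: T_def)
    ultimately have "compact T" by (metis compact_Icc compact_Int_closed)
    moreover have "T \<noteq> {}" using w by (auto simp: T_def)
    \<comment> \<open>At the first maximum, the value on the left is strictly smaller.\<close>
    ultimately obtain s where s: "s \<in> T" "\<And>u. u \<in> T \<Longrightarrow> s \<le> u"
      using compact_attains_inf[of T] by auto
    have "g 0 = 0" "g 1 = 0" by (auto simp: g_def h_def)
    then have s01: "0 < s" "s < 1"
      using s(1) \<open>\<not> g w \<le> 0\<close> by (auto simp: T_def less_le)
    \<comment> \<open>The largest radius that keeps both \<open>s - d\<close> and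
      \<open>s + d\<close> in \<open>{0..1}\<close>; it is positive because \<open>s\<close> is
      interior.\<close>
    define d where "d = min s (1 - s)"
    have d: "d > 0" "s - d \<in> {0..1}" "s + d \<in> {0..1}"
      using s01 by (auto simp: d_def)
    have "s - d \<notin> T" using s(2) d(1) by fastforce
    then have "g (s - d) < g w" using d(2) w(2)[OF d(2)] by (auto simp: T_def less_le)
    moreover have "g (s + d) \<le> g w" using w(2) d(3) by blast
    ultimately have "g s < g w" using gmid[OF d(2,3)] by simp
    then show False using s(1) by (simp add: T_def)
  qed
  then show "f ((1 - t) *\<^sub>R x + t *\<^sub>R y) \<le> (1 - t) * f x + t * f y"
    using w(2)[of t] t by (simp add: g_def h_def)
qed (fact \<open>convex S\<close>)

text \<open>Let \<open>c\<close> be the mean of \<open>a\<close> and \<open>b\<close>. Convexity of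
  the power gives \<open>c powr p \<le> D powr p + K\<close>. If \<open>D < c\<close>, replacing
  \<open>D powr p\<close> by the larger \<open>D * c powr (p - 1)\<close> turns this into a bound
  linear in \<open>c - D\<close>.\<close>

lemma mean_diff_le_of_powr:
  fixes a b D K p :: real
  assumes "1 \<le> p" "0 < a" "0 < b" "0 \<le> D" "0 \<le> K"
    and le: "(a powr p + b powr p) / 2 \<le> D powr p + K"
  shows "(a + b) / 2 - D \<le> K / ((a + b) / 2) powr (p - 1)"
proof (cases "(a + b) / 2 \<le> D")
  case True
  then show ?thesis using \<open>0 \<le> K\<close> by (smt (verit) divide_nonneg_nonneg powr_ge_zero)
next
  case False
  define c where "c = (a + b) / 2"
  have c: "0 < c" "D < c" using assms False by (auto simp: c_def)
  \<comment> \<open>The value \<open>0\<close> is included because \<open>D\<close> may vanish; both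
    sides are then \<open>0\<close>.\<close>
  have split_powr: "r powr p = r * r powr (p - 1)" if "0 \<le> r" for r :: real
    using that by (cases "r = 0") (auto simp: powr_diff)
  have "c powr p \<le> (a powr p + b powr p) / 2"
    using convex_onD[OF powr_convex[OF \<open>1 \<le> p\<close>], of "1/2" a b] assms
    by (simp add: c_def field_simps)
  then have "c * c powr (p - 1) \<le> D * D powr (p - 1) + K"
    using le c \<open>0 \<le> D\<close> by (simp flip: split_powr)
  also have "D * D powr (p - 1) \<le> D * c powr (p - 1)"
    using assms c by (intro mult_left_mono powr_mono2) auto
  finally have "(c - D) * c powr (p - 1) \<le> K" by (simp add: algebra_simps)
  then show ?thesis using c by (simp add: pos_le_divide_eq flip: c_def)
qed

lemma filterlim_dist_ray:
  assumes "ray \<gamma>"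
  shows "filterlim (\<lambda>t. dist (\<gamma> t) x) at_top at_top"
proof (rule filterlim_at_top_mono)
  show "LIM t at_top. - dist (\<gamma> 0) x + t :> at_top"
    by (rule filterlim_tendsto_add_at_top[OF tendsto_const filterlim_ident])
  show "\<forall>\<^sub>F t in at_top. - dist (\<gamma> 0) x + t \<le> dist (\<gamma> t) x"
    using eventually_ge_at_top[of 0]
  proof eventually_elim
    case (elim t)
    then have "dist (\<gamma> t) (\<gamma> 0) = t" using assms by (auto simp: ray_def)
    then show ?case using dist_triangle2[of "\<gamma> t" "\<gamma> 0" x] by simp
  qed
qed

text \<open>The triangle inequality makes each \<open>t - dist (\<gamma> t) x\<close> 1-Lipschitz in
  \<open>x\<close>, and the limit in \<open>t\<close> inherits this. It supplies the continuity
  needed to pass from midpoint convexity to convexity.\<close>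

lemma busemann_lipschitz:
  assumes "ray \<gamma>"
  shows "\<bar>busemann \<gamma> x - busemann \<gamma> y\<bar> \<le> dist x y"
proof -
  have "busemann \<gamma> x \<le> busemann \<gamma> y + dist x y" for x y
  proof (rule tendsto_le)
    show "((\<lambda>t. t - dist (\<gamma> t) y + dist x y) \<longlongrightarrow> busemann \<gamma> y + dist x y) at_top"
      by (intro tendsto_add busemann_tendsto assms tendsto_const)
    show "\<forall>\<^sub>F t in at_top. t - dist (\<gamma> t) x \<le> t - dist (\<gamma> t) y + dist x y"
    proof (intro always_eventually allI)
      show "t - dist (\<gamma> t) x \<le> t - dist (\<gamma> t) y + dist x y" for t
        using dist_triangle[of "\<gamma> t" y x] by simp
    qed
  qed (use busemann_tendsto[OF assms] in auto)
  from this[of x y] this[of y x] show ?thesis by (simp add: dist_commute)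
qed

lemma busemann_midpoint_le:
  fixes \<gamma> :: "real \<Rightarrow> 'a::metric_space"
  assumes "1 < p" "uniformly_smooth p TYPE('a)" "ray \<gamma>" "is_midpoint m y z"
  shows "busemann \<gamma> m \<le> (busemann \<gamma> y + busemann \<gamma> z) / 2"
proof -
  obtain C where C: "C > 0" "\<And>x y z m :: 'a. is_midpoint m y z \<Longrightarrow>
     dist x m powr p \<ge> 1/2 * dist x y powr p + 1/2 * dist x z powr p - C/4 * dist y z powr p"
    using assms(2) unfolding uniformly_smooth_def by blast
  define K where "K = C/4 * dist y z powr p"
  define a where "a t = (dist (\<gamma> t) y + dist (\<gamma> t) z) / 2" for t
  have "filterlim (\<lambda>t. (1/2) * (dist (\<gamma> t) y + dist (\<gamma> t) z)) at_top at_top"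
    by (intro filterlim_tendsto_pos_mult_at_top[OF tendsto_const] filterlim_at_top_add_at_top
        filterlim_dist_ray \<open>ray \<gamma>\<close>) simp
  then have "filterlim a at_top at_top" by (simp add: a_def[abs_def])
  \<comment> \<open>The strict inequality \<open>1 < p\<close> makes the exponent negative; for
    \<open>p = 1\<close> the error bound would stay at \<open>K\<close> for large
    \<open>t\<close>.\<close>
  then have "((\<lambda>t. a t powr (- (p - 1))) \<longlongrightarrow> 0) at_top"
    using \<open>1 < p\<close> by (intro tendsto_neg_powr) auto
  then have error: "((\<lambda>t. K / a t powr (p - 1)) \<longlongrightarrow> 0) at_top"
    unfolding powr_minus_divide by (auto dest: tendsto_mult_left[where c = K])
  have "busemann \<gamma> m \<le> (busemann \<gamma> y + busemann \<gamma> z) / 2 + 0"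
  proof (rule tendsto_le)
    show "((\<lambda>t. ((t - dist (\<gamma> t) y) + (t - dist (\<gamma> t) z)) / 2 + K / a t powr (p - 1)) \<longlongrightarrow>
        (busemann \<gamma> y + busemann \<gamma> z) / 2 + 0) at_top"
      by (intro tendsto_intros busemann_tendsto error \<open>ray \<gamma>\<close>) auto
    \<comment> \<open>The mean of the two approximants is \<open>t - a t\<close>, so after
      cancelling \<open>t\<close> this is the estimate of
      \<open>a t - dist (\<gamma> t) m\<close>.\<close>
    show "\<forall>\<^sub>F t in at_top. t - dist (\<gamma> t) m
        \<le> ((t - dist (\<gamma> t) y) + (t - dist (\<gamma> t) z)) / 2 + K / a t powr (p - 1)"
      \<comment> \<open>For large \<open>t\<close> both distances are positive, as
        \<open>mean_diff_le_of_powr\<close> demands.\<close>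
      using filterlim_dist_ray[OF \<open>ray \<gamma>\<close>, of y, THEN filterlim_at_top_dense[THEN iffD1], rule_format, of 0]
        filterlim_dist_ray[OF \<open>ray \<gamma>\<close>, of z, THEN filterlim_at_top_dense[THEN iffD1], rule_format, of 0]
    proof eventually_elim
      case (elim t)
      have "a t - dist (\<gamma> t) m \<le> K / a t powr (p - 1)"
        unfolding a_def using elim C(1) C(2)[OF assms(4), of "\<gamma> t"] \<open>1 < p\<close>
        by (intro mean_diff_le_of_powr) (auto simp: K_def)
      then show ?case by (simp add: a_def field_simps)
    qed
  qed (use busemann_tendsto[OF \<open>ray \<gamma>\<close>] in auto)
  then show ?thesis by simp
qed

text \<open>Constant speed turns midpoints of parameters into metric midpoints, the points about
  which uniform smoothness speaks.\<close>

lemma is_midpoint_geodesic: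
  assumes "geodesic_from_to c x y" "s \<in> {0..1}" "t \<in> {0..1}"
  shows "is_midpoint (c ((s + t) / 2)) (c s) (c t)"
proof -
  have *: "dist (c t) (c s) = \<bar>t - s\<bar> * dist x y" if "s \<in> {0..1}" "t \<in> {0..1}" for s t
    using assms(1) that unfolding geodesic_from_to_def by blast
  have m: "(s + t) / 2 \<in> {0..1}" using assms(2,3) by auto
  have "\<bar>s - (s + t) / 2\<bar> = \<bar>s - t\<bar> / 2" "\<bar>(s + t) / 2 - t\<bar> = \<bar>s - t\<bar> / 2"
    by (auto simp: abs_if field_simps)
  then show ?thesis
    unfolding is_midpoint_def *[OF m assms(2)] *[OF assms(3) m] *[OF assms(3,2)] by simp
qed

text \<open>Along a geodesic from \<open>x\<close> to \<open>y\<close> the Busemann function becomes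
  a function on \<open>{0..1}\<close> that is Lipschitz with constant \<open>dist x y\<close>, hence
  continuous, so midpoint convexity is enough.\<close>

lemma geodesically_convex_busemann:
  fixes \<gamma> :: "real \<Rightarrow> 'a::metric_space"
  assumes "1 < p" "uniformly_smooth p TYPE('a)" "ray \<gamma>"
  shows "geodesically_convex (busemann \<gamma>)"
  unfolding geodesically_convex_def
proof (intro allI impI midpoint_convex_imp_convex_on)
  fix c and x y :: 'a assume c: "geodesic_from_to c x y"
  have "(dist x y)-lipschitz_on {0..1} (\<lambda>t. busemann \<gamma> (c t))"
  proof (rule lipschitz_onI)
    fix s t :: real assume st: "s \<in> {0..1}" "t \<in> {0..1}"
    have "dist (busemann \<gamma> (c s)) (busemann \<gamma> (c t)) \<le> dist (c s) (c t)"
      using busemann_lipschitz[OF \<open>ray \<gamma>\<close>] by (simp add: dist_real_def)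
    also have "\<dots> = dist x y * dist s t"
      using c st unfolding geodesic_from_to_def by (simp add: dist_real_def)
    finally show "dist (busemann \<gamma> (c s)) (busemann \<gamma> (c t)) \<le> dist x y * dist s t" .
  qed simp
  then show "continuous_on {0..1} (\<lambda>t. busemann \<gamma> (c t))"
    by (rule lipschitz_on_continuous_on)
  show "busemann \<gamma> (c (midpoint s t)) \<le> (busemann \<gamma> (c s) + busemann \<gamma> (c t)) / 2"
    if "s \<in> {0..1}" "t \<in> {0..1}" for s t
    using busemann_midpoint_le[OF assms is_midpoint_geodesic[OF c that]]
    by (simp add: midpoint_def)
qed simp

text \<open>Each \<open>f i\<close> lies below its chord, and the chord below the combination of the
  two suprema, as both weights are nonnegative. Pointwise boundedness is what makes the real-valued
  \<open>SUP\<close> an upper bound.\<close>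

lemma convex_on_cSUP:
  fixes f :: "'i \<Rightarrow> 'a::real_vector \<Rightarrow> real"
  assumes "I \<noteq> {}" and conv: "\<And>i. i \<in> I \<Longrightarrow> convex_on S (f i)"
    and bdd: "\<And>x. x \<in> S \<Longrightarrow> bdd_above ((\<lambda>i. f i x) ` I)"
  shows "convex_on S (\<lambda>x. SUP i\<in>I. f i x)"
proof (rule convex_onI)
  fix t :: real and x y
  assume t: "0 < t" "t < 1" and xy: "x \<in> S" "y \<in> S"
  show "(SUP i\<in>I. f i ((1 - t) *\<^sub>R x + t *\<^sub>R y)) \<le> (1 - t) * (SUP i\<in>I. f i x) + t * (SUP i\<in>I. f i y)"
  proof (rule cSUP_least[OF \<open>I \<noteq> {}\<close>])
    fix i assume i: "i \<in> I"
    have "f i ((1 - t) *\<^sub>R x + t *\<^sub>R y) \<le> (1 - t) * f i x + t * f i y"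
      using convex_onD[OF conv[OF i]] t xy by simp
    also have "\<dots> \<le> (1 - t) * (SUP i\<in>I. f i x) + t * (SUP i\<in>I. f i y)"
      using t by (intro add_mono mult_left_mono cSUP_upper bdd i xy) auto
    finally show "f i ((1 - t) *\<^sub>R x + t *\<^sub>R y) \<le> \<dots>" .
  qed
next
  show "convex S" using assms(1) conv convex_on_imp_convex by blast
qed

theorem proposition3p5:
  fixes p :: real
  assumes "1 < p" and "p \<le> 2"
    and "proper_space TYPE('a::metric_space)"
    and "geodesic_space TYPE('a)"
    and "uniformly_smooth p TYPE('a)"
  shows "(\<forall>\<gamma> :: real \<Rightarrow> 'a. ray \<gamma> \<longrightarrow> geodesically_convex (busemann \<gamma>)) \<and>
         (\<forall>x0 :: 'a. (\<exists>\<gamma>. ray \<gamma> \<and> \<gamma> 0 = x0) \<longrightarrow> geodesically_convex (cheeger_gromoll x0))"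
proof (intro conjI allI impI)
  fix \<gamma> :: "real \<Rightarrow> 'a" assume "ray \<gamma>"
  then show "geodesically_convex (busemann \<gamma>)"
    using assms by (intro geodesically_convex_busemann)
next
  fix x0 :: 'a
  define I where "I = {\<gamma>. ray \<gamma> \<and> \<gamma> 0 = x0}"
  assume "\<exists>\<gamma>. ray \<gamma> \<and> \<gamma> 0 = x0"
  then have "I \<noteq> {}" by (auto simp: I_def)
  \<comment> \<open>The supremum is rewritten as one indexed by rays, the form that
    \<open>convex_on_cSUP\<close> accepts.\<close>
  have cg: "cheeger_gromoll x0 = (\<lambda>x. SUP \<gamma>\<in>I. busemann \<gamma> x)"
    by (rule ext) (auto simp: cheeger_gromoll_def I_def intro!: arg_cong[where f = Sup])
  show "geodesically_convex (cheeger_gromoll x0)"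
    unfolding geodesically_convex_def cg
  proof (intro allI impI convex_on_cSUP \<open>I \<noteq> {}\<close>)
    fix c and x y :: 'a and \<gamma> assume "geodesic_from_to c x y" "\<gamma> \<in> I"
    then show "convex_on {0..1} (\<lambda>t. busemann \<gamma> (c t))"
      using geodesically_convex_busemann[OF assms(1,5)]
      by (auto simp: I_def geodesically_convex_def)
  next
    fix c :: "real \<Rightarrow> 'a" and t :: real
    \<comment> \<open>All rays in \<open>I\<close> start at \<open>x0\<close>, so
      \<open>busemann_le\<close> gives them the common bound \<open>dist x0 (c t)\<close>.\<close>
    show "bdd_above ((\<lambda>\<gamma>. busemann \<gamma> (c t)) ` I)"
      using busemann_le by (intro bdd_aboveI2[where M = "dist x0 (c t)"]) (force simp: I_def)
  qed
qed

end
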